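(* Let $P\subset\mathbb{R}^d$ be a $d$-dimensional convex polytope (with the origin in its interior). If $P$ is first-order rigid, then $P$ is rigid.
   Context: Let $P$ have vertex set $V$, edge set $E$ and facet set $F$, and write $i\sim\sigma$ if vertex $i$ lies on facet $\sigma$. The realization space of the combinatorial type $\mathcal P=(V,E,F,\sim)$ of $P$ is the set $\mathrm{REAL}(\mathcal P)$ of pairs $(\boldsymbol p,\boldsymbol a)$ of maps $\boldsymbol p:V\to\mathbb{R}^d$, $\boldsymbol a:F\to\mathbb{R}^d$ with $\langle p_i,a_\sigma\rangle=1$ whenever $i\sim\sigma$ and $\langle p_i,a_\sigma\rangle<1$ whenever $i\not\sim\sigma$. $P$ is identified with the element $(\boldsymbol p,\boldsymbol a)\in\mathrm{REAL}(\mathcal P)$ given by its vertices $p_i$ and suitably scaled outward facet normals $a_\sigma$. Rigidity: two realizations are equivalent if the distances $\|p_i-p_j\|$ agree for all edges $ij\in E$, and congruent if they agree for all pairs $i,j\in V$. A motion of $P$ is a continuous map $[0,1]\to\mathrm{REAL}(\mathcal P)$, starting at $P$, all of whose values are equivalent to $P$; it is trivial if all its values are congruent to $P$. $P$ is rigid if all its motions are trivial. First-order rigidity: a first-order motion of $P=(\boldsymbol p,\boldsymbol a)$ is a pair $(\dot{\boldsymbol p},\dot{\boldsymbol a})$ of maps $\dot{\boldsymbol p}:V\to\mathbb{R}^d$, $\dot{\boldsymbol a}:F\to\mathbb{R}^d$ with $\langle p_i-p_j,\dot p_i-\dot p_j\rangle=0$ for all $ij\in E$ and $\langle p_i,\dot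 a_\sigma\rangle+\langle\dot p_i,a_\sigma\rangle=0$ for all $i\sim\sigma$. It is trivial if $\langle p_i-p_j,\dot p_i-\dot p_j\rangle=0$ for all $i,j\in V$. $P$ is first-order rigid if all its first-order motions are trivial. *)

theory Defs
  imports "HOL-Analysis.Analysis"
begin

record ('v, 'f) comb_type =
  verts :: "'v set"
  edges :: "'v set set"
  facets :: "'f set"
  incident :: "'v \<Rightarrow> 'f \<Rightarrow> bool"

text \<open>
  The ambient Euclidean space is an arbitrary type of class \<open>euclidean_space\<close>, of dimension
  \<open>DIM('a)\<close>. Maps on the vertex set and the facet set are represented by extensional functions,
  so that two realizations are equal iff they agree on vertices and facets, and so that the
  (product) topology of the function types restricts on \<open>REAL C\<close> to the usual topology of
  \<open>(\<real>\<^sup>d)\<^sup>V \<times> (\<real>\<^sup>d)\<^sup>F\<close>.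
\<close>

type_synonym ('v, 'f, 'a) realization = "('v \<Rightarrow> 'a) \<times> ('f \<Rightarrow> 'a)"

definition REAL :: "('v, 'f) comb_type \<Rightarrow> ('v, 'f, 'a::euclidean_space) realization set" where
  "REAL C = {(p, a). p \<in> verts C \<rightarrow>\<^sub>E UNIV \<and> a \<in> facets C \<rightarrow>\<^sub>E UNIV \<and>
     (\<forall>i \<in> verts C. \<forall>s \<in> facets C.
        (incident C i s \<longrightarrow> p i \<bullet> a s = 1) \<and> (\<not> incident C i s \<longrightarrow> p i \<bullet> a s < 1))}"

definition equivalent ::
  "('v, 'f) comb_type \<Rightarrow> ('v, 'f, 'a::euclidean_space) realization
    \<Rightarrow> ('v, 'f, 'a) realization \<Rightarrow> bool" where
  "equivalent C r r' \<longleftrightarrow>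
     (\<forall>i \<in> verts C. \<forall>j \<in> verts C. {i, j} \<in> edges C
        \<longrightarrow> dist (fst r i) (fst r j) = dist (fst r' i) (fst r' j))"

definition congruent_realizations ::
  "('v, 'f) comb_type \<Rightarrow> ('v, 'f, 'a::euclidean_space) realization
    \<Rightarrow> ('v, 'f, 'a) realization \<Rightarrow> bool" where
  "congruent_realizations C r r' \<longleftrightarrow>
     (\<forall>i \<in> verts C. \<forall>j \<in> verts C. dist (fst r i) (fst r j) = dist (fst r' i) (fst r' j))"

definition motion ::
  "('v, 'f) comb_type \<Rightarrow> ('v, 'f, 'a::euclidean_space) realization
    \<Rightarrow> (real \<Rightarrow> ('v, 'f, 'a) realization) \<Rightarrow> bool" where
  "motion C r m \<longleftrightarrow> path m \<and> path_image m \<subseteq> REAL C \<and> pathstart m = r \<and>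
     (\<forall>r' \<in> path_image m. equivalent C r' r)"

definition trivial_motion ::
  "('v, 'f) comb_type \<Rightarrow> ('v, 'f, 'a::euclidean_space) realization
    \<Rightarrow> (real \<Rightarrow> ('v, 'f, 'a) realization) \<Rightarrow> bool" where
  "trivial_motion C r m \<longleftrightarrow> (\<forall>r' \<in> path_image m. congruent_realizations C r' r)"

definition rigid_realization ::
  "('v, 'f) comb_type \<Rightarrow> ('v, 'f, 'a::euclidean_space) realization \<Rightarrow> bool" where
  "rigid_realization C r \<longleftrightarrow> (\<forall>m. motion C r m \<longrightarrow> trivial_motion C r m)"

text \<open>
  Below, only the values of \<open>p'\<close> on vertices and of \<open>a'\<close> on facets play a role.
\<close>

definition first_order_motion ::
  "('v, 'f) comb_type \<Rightarrow> ('v, 'f, 'a::euclidean_space) realization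
    \<Rightarrow> ('v \<Rightarrow> 'a) \<Rightarrow> ('f \<Rightarrow> 'a) \<Rightarrow> bool" where
  "first_order_motion C r p' a' \<longleftrightarrow>
     (\<forall>i \<in> verts C. \<forall>j \<in> verts C. {i, j} \<in> edges C
        \<longrightarrow> (fst r i - fst r j) \<bullet> (p' i - p' j) = 0) \<and>
     (\<forall>i \<in> verts C. \<forall>s \<in> facets C. incident C i s
        \<longrightarrow> fst r i \<bullet> a' s + p' i \<bullet> snd r s = 0)"

definition trivial_first_order_motion ::
  "('v, 'f) comb_type \<Rightarrow> ('v, 'f, 'a::euclidean_space) realization
    \<Rightarrow> ('v \<Rightarrow> 'a) \<Rightarrow> ('f \<Rightarrow> 'a) \<Rightarrow> bool" where
  "trivial_first_order_motion C r p' a' \<longleftrightarrow>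
     (\<forall>i \<in> verts C. \<forall>j \<in> verts C. (fst r i - fst r j) \<bullet> (p' i - p' j) = 0)"

definition first_order_rigid_realization ::
  "('v, 'f) comb_type \<Rightarrow> ('v, 'f, 'a::euclidean_space) realization \<Rightarrow> bool" where
  "first_order_rigid_realization C r \<longleftrightarrow>
     (\<forall>p' a'. first_order_motion C r p' a' \<longrightarrow> trivial_first_order_motion C r p' a')"

definition comb_type_of :: "'a::euclidean_space set \<Rightarrow> ('a, 'a set) comb_type" where
  "comb_type_of P =
     \<lparr> verts = {v. v extreme_point_of P},
       edges = {{i, j} | i j. closed_segment i j edge_of P},
       facets = {s. s facet_of P},
       incident = (\<lambda>v s. v \<in> s) \<rparr>"

text \<open>
  For a full-dimensional polytope with the origin in its interior, the description below
  determines the outward normal of a facet uniquely, see \<open>facet_normal_ex1\<close>.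
\<close>

definition facet_normal :: "'a::euclidean_space set \<Rightarrow> 'a set \<Rightarrow> 'a" where
  "facet_normal P s = (THE a. P \<subseteq> {x. x \<bullet> a \<le> 1} \<and> s = P \<inter> {x. x \<bullet> a = 1})"

definition realization_of ::
  "'a::euclidean_space set \<Rightarrow> ('a, 'a set, 'a) realization" where
  "realization_of P =
     (restrict (\<lambda>v. v) (verts (comb_type_of P)),
      restrict (facet_normal P) (facets (comb_type_of P)))"

definition rigid :: "'a::euclidean_space set \<Rightarrow> bool" where
  "rigid P \<longleftrightarrow> rigid_realization (comb_type_of P) (realization_of P)"

definition first_order_rigid :: "'a::euclidean_space set \<Rightarrow> bool" where
  "first_order_rigid P \<longleftrightarrow> first_order_rigid_realization (comb_type_of P) (realization_of P)"

lemma facet_normal_ex1: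
  fixes P :: "'a::euclidean_space set"
  assumes "polytope P" and "0 \<in> interior P" and "s facet_of P"
  shows "\<exists>!a. P \<subseteq> {x. x \<bullet> a \<le> 1} \<and> s = P \<inter> {x. x \<bullet> a = 1}"
proof -
  have full: "aff_dim P = DIM('a)"
    using assms(2) by (metis aff_dim_nonempty_interior empty_iff)
  obtain n b where n: "n \<noteq> 0" "P \<subseteq> {x. n \<bullet> x \<le> b}" "s = P \<inter> {x. n \<bullet> x = b}"
    using facet_of_polyhedron[OF polytope_imp_polyhedron[OF assms(1)] assms(3)] by metis
  have "0 \<in> interior {x. n \<bullet> x \<le> b}"
    using assms(2) interior_mono[OF n(2)] by blast
  then have b: "b > 0"
    using n(1) by simp
  define a where "a = n /\<^sub>R b"
  have eq: "x \<bullet> a = (n \<bullet> x) / b" for x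
    by (simp add: a_def inner_commute divide_inverse mult.commute)
  have a: "P \<subseteq> {x. x \<bullet> a \<le> 1} \<and> s = P \<inter> {x. x \<bullet> a = 1}"
    using n b by (auto simp: eq field_simps)
  moreover have "a' = a" if a': "P \<subseteq> {x. x \<bullet> a' \<le> 1} \<and> s = P \<inter> {x. x \<bullet> a' = 1}" for a'
  proof (rule ccontr)
    assume ne: "a' \<noteq> a"
    let ?H = "{x. (a' - a) \<bullet> x = 0}"
    have sub: "s \<subseteq> ?H"
    proof
      fix x assume x: "x \<in> s"
      then have "x \<bullet> a' = 1" "x \<bullet> a = 1" using a a' by blast+
      then show "x \<in> ?H" by (simp add: inner_diff_left inner_commute[of _ x])
    qed
    have "aff_dim s = aff_dim ?H"
      using assms(3) full ne by (simp add: facet_of_def)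
    moreover have "affine hull s \<subseteq> ?H"
      using sub by (intro hull_minimal affine_hyperplane)
    moreover have "s \<noteq> {}"
      using assms(3) by (simp add: facet_of_def)
    ultimately have "affine hull s = ?H"
      by (metis affine_affine_hull affine_hyperplane affine_dim_equal affine_hull_eq_empty
          aff_dim_affine_hull)
    then have "0 \<in> affine hull s"
      by (simp only: mem_Collect_eq inner_zero_right)
    moreover have "s \<subseteq> {x. a \<bullet> x = 1}"
      using conjunct2[OF a] by (subst inner_commute) blast
    then have "affine hull s \<subseteq> {x. a \<bullet> x = 1}"
      by (intro hull_minimal affine_hyperplane)
    ultimately have "0 \<in> {x. a \<bullet> x = 1}" by blast
    then show False by simp
  qed
  ultimately show ?thesis by (rule ex1I)
qed

lemma realization_of_in_REAL:
  fixes P :: "'a::euclidean_space set"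
  assumes "polytope P" and "0 \<in> interior P"
  shows "realization_of P \<in> REAL (comb_type_of P)"
proof -
  have "(i \<in> s \<longrightarrow> i \<bullet> facet_normal P s = 1) \<and> (i \<notin> s \<longrightarrow> i \<bullet> facet_normal P s < 1)"
    if "i extreme_point_of P" "s facet_of P" for i s
  proof -
    have "P \<subseteq> {x. x \<bullet> facet_normal P s \<le> 1} \<and> s = P \<inter> {x. x \<bullet> facet_normal P s = 1}"
      unfolding facet_normal_def by (rule theI'[OF facet_normal_ex1[OF assms that(2)]])
    then have "i \<in> s \<longleftrightarrow> i \<in> P \<and> i \<bullet> facet_normal P s = 1"
      and "i \<in> P \<Longrightarrow> i \<bullet> facet_normal P s \<le> 1"
      by blast+
    moreover have "i \<in> P" using that(1) by (simp add: extreme_point_of_def)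
    ultimately show ?thesis by (metis less_eq_real_def)
  qed
  then show ?thesis
    by (simp add: REAL_def realization_of_def comb_type_of_def)
qed

end

theory Submission
  imports Defs
begin

text \<open>
  Let \<open>q\<close> be the vertex map of a realization equivalent to \<open>P\<close>, and let \<open>\<epsilon>\<close> be the sum over all
  vertex pairs of the changes in squared distance. An affine map \<open>x \<mapsto> A x + t\<close> that agrees with
  \<open>q\<close> on an affine basis of vertices satisfies \<open>A\<^sup>T A = I + G\<close> with \<open>G = O(\<epsilon>)\<close>, and
  \<open>q i = A (i + u i) + t\<close> with \<open>u = O(\<epsilon>)\<close>. Then \<open>v i = u i + G i / 2\<close>, together with the
  correspondingly corrected facet normals, is a first-order motion of \<open>P\<close> up to errors \<open>O(\<epsilon>\<^sup>2)\<close>,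
  and \<open>2 (i - j) \<bullet> (v i - v j)\<close> is the change in squared distance up to \<open>O(\<epsilon>\<^sup>2)\<close>.
  By linear algebra, first-order rigidity bounds these strains by the constraint errors, so
  \<open>\<epsilon> = O(\<epsilon>\<^sup>2)\<close>. Hence \<open>\<epsilon>\<close> omits an interval \<open>(0, \<delta>)\<close>, and along a motion, where it is
  continuous and starts at \<open>0\<close>, it stays \<open>0\<close>. The matrix \<open>G\<close> replaces the usual alignment of \<open>q\<close>
  with \<open>P\<close> by an isometry.
\<close>

section \<open>Quantitative linear algebra for finitely many functionals\<close>

text \<open>
  Only the affine operation \<open>comb c x y = x + c y\<close> of the domain is needed; taking it as a parameter
  admits function spaces, which carry no vector space structure here.
\<close>

lemma functional_in_span_of_functionals:
  fixes comb :: "real \<Rightarrow> 'x \<Rightarrow> 'x \<Rightarrow> 'x" and f :: "'k \<Rightarrow> 'x \<Rightarrow> real" and l :: "'x \<Rightarrow> real"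
  assumes "finite K"
    and "\<And>k c x y. k \<in> K \<Longrightarrow> f k (comb c x y) = f k x + c * f k y"
    and "\<And>c x y. l (comb c x y) = l x + c * l y"
    and "\<And>x. (\<forall>k\<in>K. f k x = 0) \<Longrightarrow> l x = 0"
  shows "\<exists>c. \<forall>x. l x = (\<Sum>k\<in>K. c k * f k x)"
  using assms
proof (induction K arbitrary: l rule: finite_induct)
  case empty
  then show ?case by simp
next
  case (insert k K)
  show ?case
  proof (cases "\<forall>x. (\<forall>j\<in>K. f j x = 0) \<longrightarrow> f k x = 0")
    case True
    have "\<exists>c. \<forall>x. l x = (\<Sum>k\<in>K. c k * f k x)"
      using True insert.prems by (intro insert.IH) auto
    then obtain c where c: "\<And>x. l x = (\<Sum>k\<in>K. c k * f k x)" by blast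
    have "l x = (\<Sum>j\<in>insert k K. (c(k := 0)) j * f j x)" for x
      unfolding c using insert.hyps by (simp, intro sum.cong) auto
    then show ?thesis by blast
  next
    case False
    then obtain y where y: "\<And>j. j \<in> K \<Longrightarrow> f j y = 0" "f k y \<noteq> 0" by blast
    \<comment> \<open>A point \<open>x\<close> annihilated by all \<open>f j\<close> with
      \<open>j \<in> K\<close> can be moved along \<open>y\<close> into the kernel of
      \<open>f k\<close> as well, without changing those \<open>f j\<close>. Since
      \<open>m y = 0\<close>, the move does not change \<open>m\<close>, so \<open>m\<close>
      vanishes at every such \<open>x\<close>, and the induction hypothesis applies to it.\<close>
    define m where "m x = l x - l y / f k y * f k x" for x
    have "\<exists>c. \<forall>x. m x = (\<Sum>k\<in>K. c k * f k x)"
    proof (rule insert.IH)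
      show "m (comb c x z) = m x + c * m z" for c x z
        using insert.prems by (simp add: m_def algebra_simps)
      show "m x = 0" if "\<forall>j\<in>K. f j x = 0" for x
      proof -
        have "l (comb (- (f k x / f k y)) x y) = 0"
          using that y insert.prems(1) by (intro insert.prems(3)) auto
        then show ?thesis
          using insert.prems(2) by (simp add: m_def mult.commute)
      qed
    qed (use insert.prems in auto)
    then obtain c where c: "\<And>x. m x = (\<Sum>k\<in>K. c k * f k x)" by blast
    have "l x = (\<Sum>j\<in>insert k K. (c(k := l y / f k y)) j * f j x)" for x
    proof -
      have "(\<Sum>j\<in>K. (c(k := l y / f k y)) j * f j x) = m x"
        unfolding c using insert.hyps by (intro sum.cong) auto
      then show ?thesis using insert.hyps by (simp add: m_def)
    qed
    then show ?thesis by blast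
  qed
qed

text \<open>An inclusion of kernels becomes a linear estimate: each \<open>l m\<close> is a fixed
  combination of the \<open>f k\<close>, and the sum of the absolute values of all coefficients
  serves as \<open>C\<close>. Neither a norm nor compactness on the domain enters.\<close>

lemma functionals_bounded_by_functionals:
  fixes comb :: "real \<Rightarrow> 'x \<Rightarrow> 'x \<Rightarrow> 'x" and f :: "'k \<Rightarrow> 'x \<Rightarrow> real" and l :: "'m \<Rightarrow> 'x \<Rightarrow> real"
  assumes "finite K" "finite M"
    and f: "\<And>k c x y. k \<in> K \<Longrightarrow> f k (comb c x y) = f k x + c * f k y"
    and l: "\<And>m c x y. m \<in> M \<Longrightarrow> l m (comb c x y) = l m x + c * l m y"
    and 0: "\<And>m x. m \<in> M \<Longrightarrow> (\<forall>k\<in>K. f k x = 0) \<Longrightarrow> l m x = 0"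
  shows "\<exists>C\<ge>0. \<forall>x \<eta>. 0 \<le> \<eta> \<longrightarrow> (\<forall>k\<in>K. \<bar>f k x\<bar> \<le> \<eta>) \<longrightarrow> (\<Sum>m\<in>M. \<bar>l m x\<bar>) \<le> C * \<eta>"
proof -
  have "\<exists>c. \<forall>x. l m x = (\<Sum>k\<in>K. c k * f k x)" if "m \<in> M" for m
    by (rule functional_in_span_of_functionals[OF assms(1) f l[OF that] 0[OF that]])
  then obtain c where c: "\<And>m x. m \<in> M \<Longrightarrow> l m x = (\<Sum>k\<in>K. c m k * f k x)" by metis
  show ?thesis
  proof (intro exI conjI allI impI)
    show "0 \<le> (\<Sum>m\<in>M. \<Sum>k\<in>K. \<bar>c m k\<bar>)" by (intro sum_nonneg) auto
    fix x \<eta> assume *: "0 \<le> (\<eta>::real)" "\<forall>k\<in>K. \<bar>f k x\<bar> \<le> \<eta>"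
    have "\<bar>l m x\<bar> \<le> (\<Sum>k\<in>K. \<bar>c m k\<bar> * \<eta>)" if "m \<in> M" for m
      unfolding c[OF that]
      by (rule order_trans[OF sum_abs]) (use * in \<open>auto intro!: sum_mono mult_left_mono simp: abs_mult\<close>)
    then have "(\<Sum>m\<in>M. \<bar>l m x\<bar>) \<le> (\<Sum>m\<in>M. \<Sum>k\<in>K. \<bar>c m k\<bar> * \<eta>)" by (intro sum_mono) auto
    then show "(\<Sum>m\<in>M. \<bar>l m x\<bar>) \<le> (\<Sum>m\<in>M. \<Sum>k\<in>K. \<bar>c m k\<bar>) * \<eta>"
      by (simp add: sum_distrib_right)
  qed
qed

text \<open>A vector orthogonal to a spanning set is zero, so the pairings with \<open>S\<close>
  control all coordinates, and these control the norm.\<close>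

lemma spanning_norm_bound:
  fixes S :: "'a::euclidean_space set"
  assumes "finite S" "span S = UNIV"
  shows "\<exists>C\<ge>0. \<forall>x \<eta>. 0 \<le> \<eta> \<longrightarrow> (\<forall>s\<in>S. \<bar>x \<bullet> s\<bar> \<le> \<eta>) \<longrightarrow> norm x \<le> C * \<eta>"
proof -
  have "x \<bullet> e = 0" if "\<forall>s\<in>S. x \<bullet> s = 0" for x e
    using orthogonal_to_span[of e S x] that assms(2) by (auto simp: orthogonal_def)
  from functionals_bounded_by_functionals
      [OF assms(1) finite_Basis, of "\<lambda>s x. x \<bullet> s" "\<lambda>c x y. x + c *\<^sub>R y" "\<lambda>e x. x \<bullet> e", OF _ _ this]
  obtain C where C: "C \<ge> 0" and
    "\<And>x \<eta>. 0 \<le> \<eta> \<Longrightarrow> \<forall>s\<in>S. \<bar>x \<bullet> s\<bar> \<le> \<eta> \<Longrightarrow> (\<Sum>e\<in>Basis. \<bar>x \<bullet> e\<bar>) \<le> C * \<eta>"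
    by (auto simp: inner_add_left)
  then show ?thesis using order_trans[OF norm_le_l1] by blast
qed

section \<open>Normal form of almost isometric vertex maps\<close>

lemma inner_polarization:
  fixes a b c d :: "'a::real_inner"
  shows "(a - c) \<bullet> (b - c) = ((dist a c)\<^sup>2 + (dist b c)\<^sup>2 - (dist a b)\<^sup>2) / 2"
  by (simp add: dist_norm power2_norm_eq_inner inner_diff inner_commute algebra_simps)

text \<open>\<open>A\<close> interpolates \<open>q\<close> on a basis of vertex differences. By
  polarization it nearly preserves the Gram matrix of that basis, so the symmetric map G = A^T A - I
  is small. Then \<open>A\<close> is invertible, and pulling \<open>q i\<close> back through it
  defines \<open>u i\<close>.\<close>

lemma almost_isometric_normal_form:
  fixes V :: "'a::euclidean_space set"
  assumes V: "finite V" "z \<in> V" and span: "span ((\<lambda>i. i - z) ` V) = UNIV"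
  shows "\<exists>C\<ge>0. \<exists>\<delta>>0. \<forall>q \<epsilon>. 0 \<le> \<epsilon> \<longrightarrow> \<epsilon> \<le> \<delta> \<longrightarrow>
      (\<forall>i\<in>V. \<forall>j\<in>V. \<bar>(dist (q i) (q j))\<^sup>2 - (dist i j)\<^sup>2\<bar> \<le> \<epsilon>) \<longrightarrow>
      (\<exists>A G u (t::'a). linear A \<and> surj A \<and> linear G \<and> (\<forall>x y. A x \<bullet> A y = x \<bullet> y + x \<bullet> G y) \<and>
         (\<forall>x. norm (G x) \<le> C * \<epsilon> * norm x) \<and>
         (\<forall>i\<in>V. q i = A (i + u i) + t \<and> norm (u i) \<le> C * \<epsilon>))"
proof -
  obtain B where B: "B \<subseteq> (\<lambda>i. i - z) ` V" "independent B" "span B = UNIV"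
    using maximal_independent_subset[of "(\<lambda>i. i - z) ` V"] span
    by (metis span_mono span_span top.extremum_uniqueI)
  have finB: "finite B" using B(1) V(1) by (rule finite_surj[rotated])
  have Bz: "z + b \<in> V" if "b \<in> B" for b using B(1) that by force
  obtain C where C: "C \<ge> 0"
      "\<And>x \<eta>. 0 \<le> \<eta> \<Longrightarrow> (\<forall>s\<in>B. \<bar>x \<bullet> s\<bar> \<le> \<eta>) \<Longrightarrow> norm x \<le> C * \<eta>"
    using spanning_norm_bound[OF finB B(3)] by blast
  obtain N where N: "N > 0" "\<And>i. i \<in> V \<Longrightarrow> norm (i - z) \<le> N"
    using finite_imp_bounded[of "(\<lambda>i. i - z) ` V"] V(1) by (force simp: bounded_pos)
  \<comment> \<open>\<open>C1 * \<epsilon>\<close> will bound the operator norm of \<open>G\<close>.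
    \<open>C2 * \<epsilon>\<close> is the part of the estimate of \<open>u i\<close> that does not
    involve \<open>u i\<close> itself. The factors 2 come from polarization, whose error
    3\<epsilon>/2 is rounded up to 2\<epsilon>.\<close>
  define C1 where "C1 = C * (C * 2)"
  define C2 where "C2 = C * (2 + C * 2 * N)"
  have C12: "C1 \<ge> 0" "C2 \<ge> 0" using C(1) N(1) by (auto simp: C1_def C2_def)
  \<comment> \<open>This gives \<open>C1 * \<epsilon> \<le> 1/2\<close>, which is used twice: to
    make \<open>A\<close> injective and to absorb the norm of \<open>u i\<close> in its own
    estimate.\<close>
  define \<delta> where "\<delta> = 1 / (2 * (1 + C1))"
  have \<delta>: "\<delta> > 0" using C12 by (simp add: \<delta>_def)
  have main: "\<exists>A G u (t::'a). linear A \<and> surj A \<and> linear G \<and> (\<forall>x y. A x \<bullet> A y = x \<bullet> y + x \<bullet> G y) \<and>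
         (\<forall>x. norm (G x) \<le> (C1 + 2 * C2) * \<epsilon> * norm x) \<and>
         (\<forall>i\<in>V. q i = A (i + u i) + t \<and> norm (u i) \<le> (C1 + 2 * C2) * \<epsilon>)"
    if \<epsilon>: "0 \<le> \<epsilon>" "\<epsilon> \<le> \<delta>"
      and q: "\<forall>i\<in>V. \<forall>j\<in>V. \<bar>(dist (q i) (q j))\<^sup>2 - (dist i j)\<^sup>2\<bar> \<le> \<epsilon>" for q \<epsilon>
  proof -
    have half: "C1 * \<epsilon> \<le> 1/2"
    proof -
      have "C1 * \<epsilon> \<le> C1 * \<delta>" using \<epsilon> C12 by (intro mult_left_mono)
      also have "\<dots> \<le> 1/2" using C12 by (simp add: \<delta>_def field_simps)
      finally show ?thesis .
    qed
    have pol: "\<bar>(q i - q z) \<bullet> (q j - q z) - (i - z) \<bullet> (j - z)\<bar> \<le> 2 * \<epsilon>" if "i \<in> V" "j \<in> V" for i j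
    proof -
      have "\<bar>(dist (q i) (q z))\<^sup>2 - (dist i z)\<^sup>2\<bar> \<le> \<epsilon>" "\<bar>(dist (q j) (q z))\<^sup>2 - (dist j z)\<^sup>2\<bar> \<le> \<epsilon>"
        "\<bar>(dist (q i) (q j))\<^sup>2 - (dist i j)\<^sup>2\<bar> \<le> \<epsilon>" using q that V(2) by blast+
      then show ?thesis using \<epsilon>(1) unfolding inner_polarization abs_le_iff by (simp add: field_simps)
    qed
    obtain A where A: "linear A" "\<And>b. b \<in> B \<Longrightarrow> A b = q (z + b) - q z"
      using linear_independent_extend[OF B(2), of "\<lambda>b. q (z + b) - q z"] by blast
    define G where "G x = adjoint A (A x) - x" for x
    have linG: "linear G"
      unfolding G_def using linear_compose[OF A(1) adjoint_linear[OF A(1)]]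
      by (intro linear_compose_sub) (auto simp: o_def linear_id[unfolded id_def])
    have AG: "A x \<bullet> A y = x \<bullet> y + x \<bullet> G y" for x y
      by (simp add: G_def adjoint_works[OF A(1)] inner_diff_right)
    have Gsym: "G x \<bullet> y = x \<bullet> G y" for x y
      using AG[of x y] AG[of y x] by (simp add: inner_commute)
    have GB: "norm (G b) \<le> C * (2 * \<epsilon>)" if "b \<in> B" for b
    proof (rule C(2))
      show "\<forall>s\<in>B. \<bar>G b \<bullet> s\<bar> \<le> 2 * \<epsilon>"
      proof
        fix s assume "s \<in> B"
        then show "\<bar>G b \<bullet> s\<bar> \<le> 2 * \<epsilon>"
          using pol[OF Bz[OF that] Bz[OF \<open>s \<in> B\<close>]] AG[of b s] A(2) that by (simp add: Gsym)
      qed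
    qed (use \<epsilon> in simp)
    \<comment> \<open>By symmetry, pairing \<open>G x\<close> with a basis vector is pairing
      \<open>x\<close> with \<open>G b\<close>, which is already small; the spanning bound is thus
      applied once in each argument of the form.\<close>
    have Gx: "norm (G x) \<le> C1 * \<epsilon> * norm x" for x
    proof -
      have "norm (G x) \<le> C * (norm x * (C * (2 * \<epsilon>)))"
      proof (rule C(2))
        show "\<forall>s\<in>B. \<bar>G x \<bullet> s\<bar> \<le> norm x * (C * (2 * \<epsilon>))"
          unfolding Gsym
          by (intro ballI order_trans[OF Cauchy_Schwarz_ineq2] mult_left_mono GB) auto
      qed (use \<epsilon> C(1) in simp)
      then show ?thesis by (simp add: C1_def mult_ac)
    qed
    have "inj A"
      unfolding linear_injective_0[OF A(1)]
    proof (intro allI impI)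
      fix x assume "A x = 0"
      then have "x \<bullet> x = - (x \<bullet> G x)" using AG[of x x] by simp
      also have "\<dots> \<le> norm x * norm (G x)" using Cauchy_Schwarz_ineq2[of x "G x"] by linarith
      also have "\<dots> \<le> norm x * (1/2 * norm x)"
        by (intro mult_left_mono order_trans[OF Gx] mult_right_mono half) auto
      finally show "x = 0" by (simp add: dot_square_norm power2_eq_square mult_le_0_iff)
    qed
    then have surj: "surj A" using A(1) linear_injective_imp_surjective by blast
    define t where "t = q z - A z"
    define u where "u i = (SOME w. A (w + i) = q i - t)" for i
    have Au: "A (u i + i) = q i - t" for i
      unfolding u_def
    proof (rule someI_ex)
      obtain w where "q i - t = A w" using surj by (meson surjD)
      then show "\<exists>w. A (w + i) = q i - t" by (intro exI[of _ "w - i"]) simp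
    qed
    have unorm: "norm (u i) \<le> 2 * C2 * \<epsilon>" if i: "i \<in> V" for i
    proof -
      \<comment> \<open>\<open>?x\<close> is the preimage of \<open>q i - q z\<close>. Comparing its
        pairing with \<open>b\<close> before and after applying \<open>A\<close> isolates
        \<open>u i \<bullet> b\<close>, up to a \<open>G\<close> term that contains
        \<open>u i\<close> again; hence the norm of \<open>u i\<close> on both sides below.\<close>
      let ?x = "u i + (i - z)"
      have Ax: "A ?x = q i - q z"
        using Au[of i] by (simp add: t_def linear_add[OF A(1)] linear_diff[OF A(1)] algebra_simps)
      have "norm (u i) \<le> C * (2 * \<epsilon> + C * (2 * \<epsilon>) * (norm (u i) + N))"
      proof (rule C(2))
        show "\<forall>b\<in>B. \<bar>u i \<bullet> b\<bar> \<le> 2 * \<epsilon> + C * (2 * \<epsilon>) * (norm (u i) + N)"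
        proof
          fix b assume b: "b \<in> B"
          have "\<bar>A ?x \<bullet> A b - (i - z) \<bullet> b\<bar> \<le> 2 * \<epsilon>"
            using pol[OF i Bz[OF b]] A(2)[OF b] Ax by simp
          moreover have "A ?x \<bullet> A b - (i - z) \<bullet> b = u i \<bullet> b + ?x \<bullet> G b"
            unfolding AG by (simp add: inner_add_left)
          moreover have "\<bar>?x \<bullet> G b\<bar> \<le> (norm (u i) + N) * (C * (2 * \<epsilon>))"
            using N(1)
            by (intro order_trans[OF Cauchy_Schwarz_ineq2] mult_mono GB[OF b]
                order_trans[OF norm_triangle_ineq] add_mono N(2)[OF i]) auto
          ultimately show "\<bar>u i \<bullet> b\<bar> \<le> 2 * \<epsilon> + C * (2 * \<epsilon>) * (norm (u i) + N)"
            by (simp add: mult.commute)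
        qed
      qed (use \<epsilon> C(1) N(1) in simp)
      also have "\<dots> = C2 * \<epsilon> + C1 * \<epsilon> * norm (u i)"
        by (simp add: C1_def C2_def algebra_simps)
      also have "\<dots> \<le> C2 * \<epsilon> + 1/2 * norm (u i)"
        using half by (intro add_left_mono mult_right_mono) auto
      finally show ?thesis by simp
    qed
    have "norm (G x) \<le> (C1 + 2 * C2) * \<epsilon> * norm x" for x
      by (rule order_trans[OF Gx]) (use C12 \<epsilon> in \<open>intro mult_right_mono, auto\<close>)
    moreover have "norm (u i) \<le> (C1 + 2 * C2) * \<epsilon>" if "i \<in> V" for i
      by (rule order_trans[OF unorm[OF that]]) (use C12 \<epsilon> in \<open>intro mult_right_mono, auto\<close>)
    moreover have "q i = A (i + u i) + t" for i
      using Au[of i] by (simp add: add.commute)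
    ultimately show ?thesis
      using A(1) surj linG AG
      by - (rule exI[of _ A], rule exI[of _ G], rule exI[of _ u], rule exI[of _ t], simp)
  qed
  show ?thesis
  proof (rule exI[of _ "C1 + 2 * C2"], rule conjI, goal_cases)
    case 1
    then show ?case using C12 by simp
  next
    case 2
    show ?case by (rule exI[of _ \<delta>], rule conjI[OF \<delta>]) (intro allI impI, erule (2) main)
  qed
qed

section \<open>Hyperplanes through perturbed points\<close>

text \<open>If \<beta> were 0, then \<open>c\<close> would be almost orthogonal to a spanning set
  and hence zero, so \<open>c\<close> can be rescaled to \<open>a'\<close>. The pairing of
  \<open>a' - a\<close> with \<open>s\<close> is then \<open>- (u s \<bullet> a')\<close>, and the
  part of this bound in \<open>norm (a' - a)\<close> is absorbed. Coplanarity of the perturbed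
  points is assumed through \<open>c\<close> because a facet may have more vertices than the
  dimension.\<close>

lemma perturbed_hyperplane:
  fixes S :: "'a::euclidean_space set"
  assumes "finite S" "span S = UNIV" and a: "\<forall>s\<in>S. s \<bullet> a = 1"
  shows "\<exists>C\<ge>0. \<exists>\<delta>>0. \<forall>u c \<beta> \<eta>. 0 \<le> \<eta> \<longrightarrow> \<eta> \<le> \<delta> \<longrightarrow> c \<noteq> 0 \<longrightarrow>
     (\<forall>s\<in>S. norm (u s) \<le> \<eta> \<and> (s + u s) \<bullet> c = \<beta>) \<longrightarrow>
     (\<exists>a'. (\<forall>s\<in>S. (s + u s) \<bullet> a' = 1) \<and> norm (a' - a) \<le> C * \<eta>)"
proof -
  obtain C where C: "C \<ge> 0"
      "\<And>x \<eta>. 0 \<le> \<eta> \<Longrightarrow> (\<forall>s\<in>S. \<bar>x \<bullet> s\<bar> \<le> \<eta>) \<Longrightarrow> norm x \<le> C * \<eta>"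
    using spanning_norm_bound[OF assms(1,2)] by blast
  define \<delta> where "\<delta> = 1 / (2 * (1 + C))"
  have main: "\<exists>a'. (\<forall>s\<in>S. (s + u s) \<bullet> a' = 1) \<and> norm (a' - a) \<le> (2 * C * norm a) * \<eta>"
    if \<eta>: "0 \<le> \<eta>" "\<eta> \<le> \<delta>" and c: "c \<noteq> 0"
      and u: "\<forall>s\<in>S. norm (u s) \<le> \<eta> \<and> (s + u s) \<bullet> c = \<beta>" for u c \<beta> \<eta>
  proof -
    have half: "C * \<eta> \<le> 1/2"
    proof -
      have "C * \<eta> \<le> C * \<delta>" using \<eta> C by (intro mult_left_mono)
      also have "\<dots> \<le> 1/2" using C by (simp add: \<delta>_def field_simps)
      finally show ?thesis .
    qed
    have ub: "\<bar>u s \<bullet> x\<bar> \<le> \<eta> * norm x" if "s \<in> S" for s x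
      by (rule order_trans[OF Cauchy_Schwarz_ineq2]) (use u that in \<open>auto intro: mult_right_mono\<close>)
    have "\<beta> \<noteq> 0"
    proof
      assume "\<beta> = 0"
      have "c \<bullet> s = - (u s \<bullet> c)" if "s \<in> S" for s
      proof -
        have "s \<bullet> c + u s \<bullet> c = 0" using u that \<open>\<beta> = 0\<close> by (simp add: inner_add_left)
        then show ?thesis using inner_commute[of c s] by linarith
      qed
      then have "norm c \<le> C * (\<eta> * norm c)"
        using ub \<eta> by (intro C(2)) (simp_all del: inner_commute)
      also have "\<dots> \<le> 1/2 * norm c"
        using mult_right_mono[OF half, of "norm c"] by (simp add: mult.assoc)
      finally show False using c by simp
    qed
    define a' where "a' = c /\<^sub>R \<beta>"
    have a': "(s + u s) \<bullet> a' = 1" if "s \<in> S" for s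
      using u that \<open>\<beta> \<noteq> 0\<close> by (simp add: a'_def)
    have "norm (a' - a) \<le> C * (\<eta> * norm a')"
    proof (rule C(2))
      have "(a' - a) \<bullet> s = - (u s \<bullet> a')" if "s \<in> S" for s
        using a'[OF that] a that
        by (simp add: inner_add_left inner_commute[of _ s] inner_diff_right)
      then show "\<forall>s\<in>S. \<bar>(a' - a) \<bullet> s\<bar> \<le> \<eta> * norm a'" using ub by simp
    qed (use \<eta> in simp)
    also have "\<dots> \<le> C * (\<eta> * (norm (a' - a) + norm a))"
      using C \<eta> norm_triangle_ineq[of "a' - a" a] by (intro mult_left_mono) auto
    also have "\<dots> \<le> 1/2 * norm (a' - a) + C * \<eta> * norm a"
      using mult_right_mono[OF half, of "norm (a' - a)"] by (simp add: algebra_simps)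
    finally have "norm (a' - a) \<le> (2 * C * norm a) * \<eta>" by (simp add: mult_ac)
    then show ?thesis using a' by blast
  qed
  show ?thesis
  proof (rule exI[of _ "2 * C * norm a"], rule conjI, goal_cases)
    case 1
    then show ?case using C(1) by simp
  next
    case 2
    have "\<delta> > 0" using C(1) by (simp add: \<delta>_def)
    show ?case
      by (rule exI[of _ \<delta>], rule conjI[OF \<open>\<delta> > 0\<close>]) (intro allI impI, erule (3) main)
  qed
qed

section \<open>Spanning sets of vertices\<close>

lemma span_eq_UNIV_if_not_in_hyperplane:
  fixes S :: "'a::euclidean_space set"
  assumes "\<And>n. n \<noteq> 0 \<Longrightarrow> \<exists>s\<in>S. n \<bullet> s \<noteq> 0"
  shows "span S = UNIV"
proof (rule ccontr)
  assume "span S \<noteq> UNIV"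
  then obtain n where "n \<noteq> 0" "\<And>x. x \<in> span S \<Longrightarrow> n \<bullet> x = 0"
    using span_not_univ_subset_hyperplane[of S] by auto
  then show False using assms span_base by blast
qed

text \<open>By Krein-Milman a hyperplane through all vertices would contain P, which has interior
  points. This supplies the basis on which \<open>A\<close> interpolates \<open>q\<close>.\<close>

lemma span_vertex_differences:
  fixes P :: "'a::euclidean_space set"
  assumes "polytope P" "interior P \<noteq> {}"
  shows "span ((\<lambda>i. i - z) ` {v. v extreme_point_of P}) = UNIV"
proof (rule span_eq_UNIV_if_not_in_hyperplane)
  fix n :: 'a assume n: "n \<noteq> 0"
  let ?V = "{v. v extreme_point_of P}"
  show "\<exists>s\<in>(\<lambda>i. i - z) ` ?V. n \<bullet> s \<noteq> 0"
  proof (rule ccontr)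
    assume "\<not> ?thesis"
    then have "?V \<subseteq> {x. n \<bullet> x = n \<bullet> z}" by (auto simp: inner_diff_right)
    then have "convex hull ?V \<subseteq> {x. n \<bullet> x = n \<bullet> z}"
      by (intro hull_minimal convex_hyperplane)
    then have "P \<subseteq> {x. n \<bullet> x = n \<bullet> z}"
      using Krein_Milman_Minkowski[OF polytope_imp_compact polytope_imp_convex] assms(1) by metis
    then have "interior P \<subseteq> interior {x. n \<bullet> x = n \<bullet> z}" by (rule interior_mono)
    then show False using assms(2) n by simp
  qed
qed

text \<open>A hyperplane through the origin containing the vertices of \<open>s\<close> would equal
  the affine hull of \<open>s\<close> by dimension, but that hull lies in the hyperplane of points
  pairing to 1 with \<open>a\<close>, which misses the origin.\<close>

lemma span_facet_vertices:
  fixes P :: "'a::euclidean_space set"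
  assumes "polytope P" "0 \<in> interior P" "s facet_of P" "\<forall>x\<in>s. x \<bullet> a = 1"
  shows "span {v. v extreme_point_of P \<and> v \<in> s} = UNIV"
proof (rule span_eq_UNIV_if_not_in_hyperplane)
  fix n :: 'a assume n: "n \<noteq> 0"
  let ?V = "{v. v extreme_point_of P \<and> v \<in> s}"
  have face: "s face_of P" and ne: "s \<noteq> {}" and dim: "aff_dim s = aff_dim P - 1"
    using assms(3) by (auto simp: facet_of_def)
  have s: "polytope s" using face assms(1) face_of_polytope_polytope by blast
  have V: "{v. v extreme_point_of s} = ?V"
    using extreme_point_of_face[OF face] by blast
  show "\<exists>v\<in>?V. n \<bullet> v \<noteq> 0"
  proof (rule ccontr)
    assume "\<not> ?thesis"
    then have "?V \<subseteq> {x. n \<bullet> x = 0}" by auto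
    then have "convex hull ?V \<subseteq> {x. n \<bullet> x = 0}"
      by (intro hull_minimal convex_hyperplane)
    then have "s \<subseteq> {x. n \<bullet> x = 0}"
      using Krein_Milman_Minkowski[OF polytope_imp_compact polytope_imp_convex] s V by metis
    then have "affine hull s \<subseteq> {x. n \<bullet> x = 0}" by (intro hull_minimal affine_hyperplane)
    moreover have "aff_dim P = DIM('a)"
      using assms(2) by (metis aff_dim_nonempty_interior empty_iff)
    then have "aff_dim (affine hull s) = aff_dim {x. n \<bullet> x = 0}"
      using dim n by simp
    ultimately have "affine hull s = {x. n \<bullet> x = 0}"
      using ne by (metis affine_affine_hull affine_hyperplane affine_dim_equal affine_hull_eq_empty)
    then have "0 \<in> affine hull s" by simp
    moreover have "affine hull s \<subseteq> {x. a \<bullet> x = 1}"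
      using assms(4) by (intro hull_minimal affine_hyperplane) (auto simp: inner_commute)
    ultimately show False by auto
  qed
qed

section \<open>Second-order expansion of squared lengths, and the distortion\<close>

text \<open>Expanding the squared norm of \<open>A (w + h)\<close> through \<open>AG\<close>, the
  terms linear in \<open>h\<close> and \<open>G\<close> are exactly the strain on the left, and what
  remains is \<open>h \<bullet> h + 2 * (h \<bullet> G w) + h \<bullet> G h\<close>. The assumption
  \<kappa> \<le> 1 makes the last, cubic term quadratic. In the application \<open>w = i - j\<close>
  and \<open>h = u i - u j\<close>.\<close>

lemma strain_expansion:
  fixes A G :: "'a::euclidean_space \<Rightarrow> 'a"
  assumes G: "linear G" and AG: "\<And>x y. A x \<bullet> A y = x \<bullet> y + x \<bullet> G y"
    and bound: "\<And>x. norm (G x) \<le> \<kappa> * norm x"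
    and \<kappa>: "0 \<le> \<kappa>" "\<kappa> \<le> 1" and w: "norm w \<le> L" and h: "norm h \<le> 2 * \<kappa>"
  shows "\<bar>2 * (w \<bullet> (h + G w /\<^sub>R 2)) - ((norm (A (w + h)))\<^sup>2 - (norm w)\<^sup>2)\<bar> \<le> (8 + 4 * L) * \<kappa>\<^sup>2"
proof -
  have sym: "w \<bullet> G h = h \<bullet> G w"
    using AG[of w h] AG[of h w] by (simp add: inner_commute)
  have "2 * (w \<bullet> (h + G w /\<^sub>R 2)) - ((norm (A (w + h)))\<^sup>2 - (norm w)\<^sup>2)
      = - (h \<bullet> h + 2 * (h \<bullet> G w) + h \<bullet> G h)"
    unfolding power2_norm_eq_inner AG
    by (simp add: linear_add[OF G] inner_add_left inner_add_right sym inner_commute[of h w])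
  also have "\<bar>\<dots>\<bar> = \<bar>h \<bullet> h + 2 * (h \<bullet> G w) + h \<bullet> G h\<bar>"
    by (simp only: abs_minus_cancel)
  finally show ?thesis
  proof (rule ord_eq_le_trans)
    have "\<bar>h \<bullet> h\<bar> \<le> (2 * \<kappa>) * (2 * \<kappa>)"
      by (rule order_trans[OF Cauchy_Schwarz_ineq2], rule mult_mono) (use h \<kappa> in auto)
    moreover have "\<bar>h \<bullet> G w\<bar> \<le> (2 * \<kappa>) * (\<kappa> * L)"
    proof (rule order_trans[OF Cauchy_Schwarz_ineq2], rule mult_mono)
      show "norm (G w) \<le> \<kappa> * L"
        by (rule order_trans[OF bound]) (use w \<kappa> in \<open>auto intro: mult_left_mono\<close>)
    qed (use h \<kappa> in auto)
    moreover have "\<bar>h \<bullet> G h\<bar> \<le> (2 * \<kappa>) * (2 * \<kappa>)"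
    proof (rule order_trans[OF Cauchy_Schwarz_ineq2], rule mult_mono)
      have "norm (G h) \<le> \<kappa> * (2 * \<kappa>)"
        by (rule order_trans[OF bound]) (use h \<kappa> in \<open>auto intro: mult_left_mono\<close>)
      also have "\<dots> \<le> 1 * (2 * \<kappa>)" by (rule mult_right_mono) (use \<kappa> in auto)
      finally show "norm (G h) \<le> 2 * \<kappa>" by simp
    qed (use h \<kappa> in auto)
    moreover have "(8 + 4 * L) * \<kappa>\<^sup>2 = (2 * \<kappa>) * (2 * \<kappa>) + 2 * ((2 * \<kappa>) * (\<kappa> * L)) + (2 * \<kappa>) * (2 * \<kappa>)"
      by (simp add: power2_eq_square algebra_simps)
    ultimately show "\<bar>h \<bullet> h + 2 * (h \<bullet> G w) + h \<bullet> G h\<bar> \<le> (8 + 4 * L) * \<kappa>\<^sup>2"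
      by linarith
  qed
qed

text \<open>Distances are squared because first-order strain is the linear part of their change. The
  reference configuration is the inclusion map, since the vertices of \<open>comb_type_of P\<close>
  are themselves points.\<close>

definition distortion :: "'a::metric_space set \<Rightarrow> ('a \<Rightarrow> 'b::metric_space) \<Rightarrow> real" where
  "distortion V q = (\<Sum>(i, j)\<in>V \<times> V. \<bar>(dist (q i) (q j))\<^sup>2 - (dist i j)\<^sup>2\<bar>)"

lemma distortion_ge:
  assumes "finite V" "i \<in> V" "j \<in> V"
  shows "\<bar>(dist (q i) (q j))\<^sup>2 - (dist i j)\<^sup>2\<bar> \<le> distortion V q"
  using member_le_sum[of "(i, j)" "V \<times> V" "\<lambda>(i, j). \<bar>(dist (q i) (q j))\<^sup>2 - (dist i j)\<^sup>2\<bar>"] assms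
  by (auto simp: distortion_def)

lemma distortion_nonneg: "0 \<le> distortion V q"
  unfolding distortion_def by (intro sum_nonneg) auto

section \<open>Uniform estimates for the polytope\<close>

text \<open>First-order rigidity says that the strains of all vertex pairs vanish on the common
  kernel of the edge and incidence functionals, so the general bound for functionals
  applies.\<close>

lemma first_order_rigid_bound:
  fixes P :: "'a::euclidean_space set"
  assumes "polytope P" "first_order_rigid P"
  defines "V \<equiv> {v. v extreme_point_of P}"
  shows "\<exists>C\<ge>0. \<forall>v a \<eta>. 0 \<le> \<eta> \<longrightarrow>
    (\<forall>i\<in>V. \<forall>j\<in>V. {i, j} \<in> edges (comb_type_of P) \<longrightarrow> \<bar>(i - j) \<bullet> (v i - v j)\<bar> \<le> \<eta>) \<longrightarrow>
    (\<forall>s. s facet_of P \<longrightarrow> (\<forall>i\<in>V \<inter> s. \<bar>i \<bullet> a s + v i \<bullet> facet_normal P s\<bar> \<le> \<eta>)) \<longrightarrow>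
    (\<Sum>(i, j)\<in>V \<times> V. \<bar>(i - j) \<bullet> (v i - v j)\<bar>) \<le> C * \<eta>"
proof -
  define E where "E = {(i, j) \<in> V \<times> V. {i, j} \<in> edges (comb_type_of P)}"
  define I where "I = {(i, s) \<in> V \<times> {s. s facet_of P}. i \<in> s}"
  define l where "l = (\<lambda>(i, j) (x :: ('a \<Rightarrow> 'a) \<times> ('a set \<Rightarrow> 'a)). (i - j) \<bullet> (fst x i - fst x j))"
  define g where "g = (\<lambda>(i, s) (x :: ('a \<Rightarrow> 'a) \<times> ('a set \<Rightarrow> 'a)).
    i \<bullet> snd x s + fst x i \<bullet> facet_normal P s)"
  define comb where "comb c x y = ((\<lambda>i. fst x i + c *\<^sub>R fst y i), (\<lambda>s. snd x s + c *\<^sub>R snd y s))"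
    for c and x y :: "('a \<Rightarrow> 'a) \<times> ('a set \<Rightarrow> 'a)"
  have V: "finite V"
    using assms(1) finite_polyhedron_extreme_points polytope_imp_polyhedron by (auto simp: V_def)
  have E: "finite E" by (rule finite_subset[of _ "V \<times> V"]) (auto simp: E_def V)
  have I: "finite I"
    by (rule finite_subset[of _ "V \<times> {s. s facet_of P}"])
      (auto simp: I_def V finite_polytope_facets[OF assms(1)])
  have l: "l m (comb c x y) = l m x + c * l m y" for m c x y
    by (cases m) (simp add: l_def comb_def inner_add_right inner_diff_right algebra_simps)
  have g: "g m (comb c x y) = g m x + c * g m y" for m c x y
    by (cases m) (simp add: g_def comb_def inner_add_right inner_add_left algebra_simps)
  \<comment> \<open>The disjoint sum joins edge and incidence constraints into one index
    set.\<close>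
  have "\<exists>C\<ge>0. \<forall>x \<eta>. 0 \<le> \<eta> \<longrightarrow> (\<forall>k\<in>E <+> I. \<bar>case_sum l g k x\<bar> \<le> \<eta>)
      \<longrightarrow> (\<Sum>m\<in>V \<times> V. \<bar>l m x\<bar>) \<le> C * \<eta>"
  proof (rule functionals_bounded_by_functionals)
    show "case_sum l g k (comb c x y) = case_sum l g k x + c * case_sum l g k y" for k c x y
      by (cases k) (simp_all add: l g)
    fix m x assume m: "m \<in> V \<times> V" and 0: "\<forall>k\<in>E <+> I. case_sum l g k x = 0"
    have "l e x = 0" if "e \<in> E" for e using 0 that by force
    moreover have "g e x = 0" if "e \<in> I" for e using 0 that by force
    ultimately have "first_order_motion (comb_type_of P) (realization_of P) (fst x) (snd x)"
      by (auto simp: first_order_motion_def realization_of_def E_def I_def l_def g_def V_def comb_type_of_def)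
    then have "trivial_first_order_motion (comb_type_of P) (realization_of P) (fst x) (snd x)"
      using assms(2) by (simp add: first_order_rigid_def first_order_rigid_realization_def)
    then show "l m x = 0"
      using m by (auto simp: trivial_first_order_motion_def realization_of_def l_def V_def comb_type_of_def)
  qed (use V E I l in auto)
  then obtain C where C: "C \<ge> 0" "\<And>x \<eta>. 0 \<le> \<eta> \<Longrightarrow> (\<forall>k\<in>E <+> I. \<bar>case_sum l g k x\<bar> \<le> \<eta>)
      \<Longrightarrow> (\<Sum>m\<in>V \<times> V. \<bar>l m x\<bar>) \<le> C * \<eta>" by blast
  show ?thesis
  proof (rule exI[of _ C], intro conjI allI impI, rule C(1))
    fix v a and \<eta> :: real
    assume \<eta>: "0 \<le> \<eta>"
      and e: "\<forall>i\<in>V. \<forall>j\<in>V. {i, j} \<in> edges (comb_type_of P) \<longrightarrow> \<bar>(i - j) \<bullet> (v i - v j)\<bar> \<le> \<eta>"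
      and s: "\<forall>s. s facet_of P \<longrightarrow> (\<forall>i\<in>V \<inter> s. \<bar>i \<bullet> a s + v i \<bullet> facet_normal P s\<bar> \<le> \<eta>)"
    have "\<forall>k\<in>E <+> I. \<bar>case_sum l g k (v, a)\<bar> \<le> \<eta>"
      using e s by (auto simp: E_def I_def l_def g_def)
    from C(2)[OF \<eta> this] show "(\<Sum>(i, j)\<in>V \<times> V. \<bar>(i - j) \<bullet> (v i - v j)\<bar>) \<le> C * \<eta>"
      by (simp add: l_def case_prod_beta)
  qed
qed

text \<open>There are finitely many facets, so the constants of \<open>perturbed_hyperplane\<close>
  can be made uniform.\<close>

lemma perturbed_facets:
  fixes P :: "'a::euclidean_space set"
  assumes "polytope P" "0 \<in> interior P"
  defines "V \<equiv> {v. v extreme_point_of P}"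
  shows "\<exists>C\<ge>0. \<exists>\<delta>>0. \<forall>s u c \<beta> \<eta>. s facet_of P \<longrightarrow> 0 \<le> \<eta> \<longrightarrow> \<eta> \<le> \<delta> \<longrightarrow> c \<noteq> 0 \<longrightarrow>
     (\<forall>i\<in>V \<inter> s. norm (u i) \<le> \<eta> \<and> (i + u i) \<bullet> c = \<beta>) \<longrightarrow>
     (\<exists>a. (\<forall>i\<in>V \<inter> s. (i + u i) \<bullet> a = 1) \<and> norm (a - facet_normal P s) \<le> C * \<eta>)"
proof -
  define F where "F = {s. s facet_of P}"
  have F: "finite F" using finite_polytope_facets[OF assms(1)] by (simp add: F_def)
  define Q where "Q s C \<delta> \<longleftrightarrow> (\<forall>u c \<beta> \<eta>. 0 \<le> \<eta> \<longrightarrow> \<eta> \<le> \<delta> \<longrightarrow> c \<noteq> 0 \<longrightarrow>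
     (\<forall>i\<in>V \<inter> s. norm (u i) \<le> \<eta> \<and> (i + u i) \<bullet> c = \<beta>) \<longrightarrow>
     (\<exists>a. (\<forall>i\<in>V \<inter> s. (i + u i) \<bullet> a = 1) \<and> norm (a - facet_normal P s) \<le> C * \<eta>))" for s C \<delta>
  have V: "finite V"
    using assms(1) finite_polyhedron_extreme_points polytope_imp_polyhedron by (auto simp: V_def)
  have "\<exists>C\<ge>0. \<exists>\<delta>>0. Q s C \<delta>" if "s \<in> F" for s
    unfolding Q_def
  proof (rule perturbed_hyperplane)
    have s: "s facet_of P" using that by (simp add: F_def)
    have "P \<subseteq> {x. x \<bullet> facet_normal P s \<le> 1} \<and> s = P \<inter> {x. x \<bullet> facet_normal P s = 1}"
      unfolding facet_normal_def by (rule theI'[OF facet_normal_ex1[OF assms(1,2) s]])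
    then have n: "\<forall>x\<in>s. x \<bullet> facet_normal P s = 1" by blast
    show "span (V \<inter> s) = UNIV"
      using span_facet_vertices[OF assms(1,2) s n] by (simp add: V_def Int_def)
    show "\<forall>i\<in>V \<inter> s. i \<bullet> facet_normal P s = 1" using n by blast
  qed (use V in simp)
  then obtain C \<delta> where Q: "\<And>s. s \<in> F \<Longrightarrow> C s \<ge> 0 \<and> \<delta> s > 0 \<and> Q s (C s) (\<delta> s)" by metis
  \<comment> \<open>The inserted 1 ensures that the minimum is taken over a nonempty set.\<close>
  have "Q s (sum C F) (Min (insert 1 (\<delta> ` F)))" if sF: "s \<in> F" for s
    unfolding Q_def
  proof (intro allI impI)
    fix u :: "'a \<Rightarrow> 'a" and c :: 'a and \<beta> \<eta> :: real
    assume *: "0 \<le> \<eta>" "\<eta> \<le> Min (insert 1 (\<delta> ` F))" "c \<noteq> 0"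
      "\<forall>i\<in>V \<inter> s. norm (u i) \<le> \<eta> \<and> (i + u i) \<bullet> c = \<beta>"
    have "\<eta> \<le> \<delta> s" using *(2) F sF by simp
    then obtain a where a: "\<forall>i\<in>V \<inter> s. (i + u i) \<bullet> a = 1" "norm (a - facet_normal P s) \<le> C s * \<eta>"
      using Q[OF sF] * unfolding Q_def by blast
    have "C s * \<eta> \<le> sum C F * \<eta>"
      using Q F sF *(1) by (intro mult_right_mono member_le_sum) auto
    then show "\<exists>a. (\<forall>i\<in>V \<inter> s. (i + u i) \<bullet> a = 1) \<and> norm (a - facet_normal P s) \<le> sum C F * \<eta>"
      using a by (intro exI[of _ a] conjI) auto
  qed
  moreover have "sum C F \<ge> 0" using Q by (intro sum_nonneg) auto
  moreover have "Min (insert 1 (\<delta> ` F)) > 0" using Q F by auto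
  ultimately have "\<exists>C\<ge>0. \<exists>\<delta>>0. \<forall>s\<in>F. Q s C \<delta>" by blast
  then show ?thesis unfolding Q_def F_def by (simp only: mem_Collect_eq Ball_def) metis
qed

section \<open>The distortion gap and rigidity\<close>

text \<open>The estimates combine to \<epsilon> \<le>
  \<open>K * C2\<^sup>2 * \<epsilon> * \<epsilon>\<close>, which excludes small positive \<epsilon>.
  Only a gap is claimed: distant equivalent realizations may fail to be congruent to P.\<close>

lemma distortion_gap:
  fixes P :: "'a::euclidean_space set"
  assumes P: "polytope P" "0 \<in> interior P" and "first_order_rigid P"
  defines "V \<equiv> {v. v extreme_point_of P}"
  shows "\<exists>\<delta>>0. \<forall>q b. (q, b) \<in> REAL (comb_type_of P) \<longrightarrow>
    equivalent (comb_type_of P) (q, b) (realization_of P) \<longrightarrow>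
    distortion V q < \<delta> \<longrightarrow> distortion V q = 0"
proof -
  have V: "finite V"
    using P(1) finite_polyhedron_extreme_points polytope_imp_polyhedron by (auto simp: V_def)
  have "V \<noteq> {}"
    using Krein_Milman_Minkowski[OF polytope_imp_compact[OF P(1)] polytope_imp_convex[OF P(1)]]
      P(2) unfolding V_def by (metis convex_hull_empty empty_iff interior_empty)
  then obtain z where z: "z \<in> V" by blast
  obtain N where N: "N > 0" "\<And>i. i \<in> V \<Longrightarrow> norm i \<le> N"
    using finite_imp_bounded[OF V] by (auto simp: bounded_pos)
  from first_order_rigid_bound[OF P(1) assms(3), folded V_def]
  obtain C0 where "C0 \<ge> 0" and *: "\<forall>v a \<eta>. 0 \<le> \<eta> \<longrightarrow>
    (\<forall>i\<in>V. \<forall>j\<in>V. {i, j} \<in> edges (comb_type_of P) \<longrightarrow> \<bar>(i - j) \<bullet> (v i - v j)\<bar> \<le> \<eta>) \<longrightarrow>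
    (\<forall>s. s facet_of P \<longrightarrow> (\<forall>i\<in>V \<inter> s. \<bar>i \<bullet> a s + v i \<bullet> facet_normal P s\<bar> \<le> \<eta>)) \<longrightarrow>
    (\<Sum>(i, j)\<in>V \<times> V. \<bar>(i - j) \<bullet> (v i - v j)\<bar>) \<le> C0 * \<eta>"
    by (elim exE conjE) (rule that)
  note C0 = this(1) *[THEN spec, THEN spec, THEN spec, THEN mp, THEN mp, THEN mp]
  from perturbed_facets[OF P, folded V_def]
  obtain C1 \<delta>1 where "C1 \<ge> 0" "\<delta>1 > 0" and *: "\<forall>s u c \<beta> \<eta>. s facet_of P \<longrightarrow> 0 \<le> \<eta> \<longrightarrow> \<eta> \<le> \<delta>1 \<longrightarrow> c \<noteq> 0 \<longrightarrow>
     (\<forall>i\<in>V \<inter> s. norm (u i) \<le> \<eta> \<and> (i + u i) \<bullet> c = \<beta>) \<longrightarrow>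
     (\<exists>a. (\<forall>i\<in>V \<inter> s. (i + u i) \<bullet> a = 1) \<and> norm (a - facet_normal P s) \<le> C1 * \<eta>)"
    by (elim exE conjE) (rule that)
  note C1 = this(1,2) *[THEN spec, THEN spec, THEN spec, THEN spec, THEN spec,
      THEN mp, THEN mp, THEN mp, THEN mp, THEN mp]
  have "span ((\<lambda>i. i - z) ` V) = UNIV"
    using span_vertex_differences[OF P(1)] P(2) unfolding V_def by blast
  from almost_isometric_normal_form[OF V z this]
  obtain C2 \<delta>2 where "C2 \<ge> 0" "\<delta>2 > 0" and *: "\<forall>q \<epsilon>. 0 \<le> \<epsilon> \<longrightarrow> \<epsilon> \<le> \<delta>2 \<longrightarrow>
      (\<forall>i\<in>V. \<forall>j\<in>V. \<bar>(dist (q i) (q j))\<^sup>2 - (dist i j)\<^sup>2\<bar> \<le> \<epsilon>) \<longrightarrow>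
      (\<exists>A G u (t::'a). linear A \<and> surj A \<and> linear G \<and> (\<forall>x y. A x \<bullet> A y = x \<bullet> y + x \<bullet> G y) \<and>
         (\<forall>x. norm (G x) \<le> C2 * \<epsilon> * norm x) \<and>
         (\<forall>i\<in>V. q i = A (i + u i) + t \<and> norm (u i) \<le> C2 * \<epsilon>))"
    by (elim exE conjE) (rule that)
  note C2 = this(1,2) *[THEN spec, THEN spec, THEN mp, THEN mp, THEN mp]
  \<comment> \<open>The first summand is twice the bound on the total strain, the second the
    quadratic remainder of \<open>strain_expansion\<close> with \<open>L = 2 * N\<close>, once for
    each ordered vertex pair.\<close>
  define K where "K = 2 * C0 * (8 + 8 * N + C1) + card (V \<times> V) * (8 + 8 * N)"
  have K: "K \<ge> 0" using C0 C1(1) N by (simp add: K_def)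
  \<comment> \<open>The three thresholds admit the normal form, give \<kappa> \<le> 1 and \<kappa>
    \<le> \<open>\<delta>1\<close>, and yield the final contradiction.\<close>
  define \<delta> where "\<delta> = Min {\<delta>2, min 1 \<delta>1 / (1 + C2), 1 / (1 + K * C2\<^sup>2)}"
  have "\<delta> > 0"
    using C1(2) C2(1,2) K by (auto simp: \<delta>_def add_pos_nonneg)
  moreover have "distortion V q = 0"
    if real: "(q, b) \<in> REAL (comb_type_of P)"
      and eq: "equivalent (comb_type_of P) (q, b) (realization_of P)"
      and small: "distortion V q < \<delta>" for q b
  proof (rule ccontr)
    define \<epsilon> where "\<epsilon> = distortion V q"
    assume "distortion V q \<noteq> 0"
    then have \<epsilon>: "\<epsilon> > 0" using distortion_nonneg[of V q] by (simp add: \<epsilon>_def)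
    have \<epsilon>2: "\<epsilon> \<le> \<delta>2" and \<epsilon>1: "\<epsilon> < min 1 \<delta>1 / (1 + C2)" and \<epsilon>K: "\<epsilon> < 1 / (1 + K * C2\<^sup>2)"
      using small by (auto simp: \<delta>_def \<epsilon>_def)
    define \<kappa> where "\<kappa> = C2 * \<epsilon>"
    have "\<kappa> \<le> (1 + C2) * \<epsilon>" using \<epsilon> by (simp add: \<kappa>_def algebra_simps)
    also have "\<dots> < min 1 \<delta>1" using \<epsilon>1 C2(1) by (simp add: field_simps)
    finally have \<kappa>: "0 \<le> \<kappa>" "\<kappa> \<le> 1" "\<kappa> \<le> \<delta>1" using C2(1) \<epsilon> by (auto simp: \<kappa>_def)
    have "\<forall>i\<in>V. \<forall>j\<in>V. \<bar>(dist (q i) (q j))\<^sup>2 - (dist i j)\<^sup>2\<bar> \<le> \<epsilon>"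
      unfolding \<epsilon>_def using distortion_ge[OF V] by blast
    from C2(3)[OF less_imp_le[OF \<epsilon>] \<epsilon>2 this, folded \<kappa>_def] obtain A G u t where
      A: "linear A" "surj A" and G: "linear G" and "\<forall>x y. A x \<bullet> A y = x \<bullet> y + x \<bullet> G y"
      and "\<forall>x. norm (G x) \<le> \<kappa> * norm x"
      and qu: "\<forall>i\<in>V. q i = A (i + u i) + t \<and> norm (u i) \<le> \<kappa>"
      by (elim exE conjE) (rule that)
    note AG = this(4)[rule_format] and Gb = this(5)[rule_format]
    have q: "q i = A (i + u i) + t" and u: "norm (u i) \<le> \<kappa>" if "i \<in> V" for i
      using qu that by blast+
    have Gsym: "G x \<bullet> y = x \<bullet> G y" for x y
      using AG[of x y] AG[of y x] by (simp add: inner_commute)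
    define n where "n = facet_normal P"
    have n: "i \<bullet> n s = 1" and qb: "q i \<bullet> b s = 1" if "s facet_of P" "i \<in> V \<inter> s" for i s
      using realization_of_in_REAL[OF P] real that
      by (auto simp: REAL_def realization_of_def comb_type_of_def V_def n_def)
    \<comment> \<open>The facet normal \<open>b s\<close> of the realization is pulled back by the
      adjoint of \<open>A\<close>: the pulled-back vertices \<open>i + u i\<close> of the facet then
      lie on a common hyperplane, with the translation \<open>t\<close> moved into its right-hand
      side.\<close>
    have "\<exists>c. (\<forall>i\<in>V \<inter> s. (i + u i) \<bullet> c = 1) \<and> norm (c - n s) \<le> C1 * \<kappa>" if s: "s facet_of P" for s
      unfolding n_def
    proof (rule C1(3)[OF s \<kappa>(1,3)])
      show "\<forall>i\<in>V \<inter> s. norm (u i) \<le> \<kappa> \<and> (i + u i) \<bullet> adjoint A (b s) = 1 - t \<bullet> b s"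
      proof (intro ballI conjI)
        fix i assume i: "i \<in> V \<inter> s"
        then have "A (i + u i) \<bullet> b s + t \<bullet> b s = 1"
          using qb[OF s i] q[of i] by (simp add: inner_add_left)
        then show "(i + u i) \<bullet> adjoint A (b s) = 1 - t \<bullet> b s"
          by (simp only: adjoint_works[OF A(1)])
      qed (use u in auto)
      show "adjoint A (b s) \<noteq> 0"
      proof
        assume 0: "adjoint A (b s) = 0"
        have "A x \<bullet> b s = 0" for x
          using adjoint_works[OF A(1), of x "b s"] 0 by simp
        then have "b s = 0" using A(2) by (metis inner_eq_zero_iff surjD)
        moreover have "V \<inter> s \<noteq> {}"
        proof -
          have "polytope s" "s \<noteq> {}"
            using s P(1) face_of_polytope_polytope by (auto simp: facet_of_def)
          then have "{x. x extreme_point_of s} \<noteq> {}"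
            using Krein_Milman_Minkowski[OF polytope_imp_compact polytope_imp_convex, of s]
            by (metis convex_hull_empty)
          then show ?thesis
            using s extreme_point_of_face unfolding V_def facet_of_def by blast
        qed
        ultimately show False using qb[OF s] by auto
      qed
    qed
    then obtain c where c: "\<And>s i. s facet_of P \<Longrightarrow> i \<in> V \<inter> s \<Longrightarrow> (i + u i) \<bullet> c s = 1"
        "\<And>s. s facet_of P \<Longrightarrow> norm (c s - n s) \<le> C1 * \<kappa>"
      by metis
    \<comment> \<open>Half of \<open>G\<close> accounts for the change of metric, because the strain
      is doubled in \<open>strain_expansion\<close>. Normals receive the opposite correction, so
      that by symmetry of \<open>G\<close> the two cancel in every incidence equation.\<close>
    define v where "v i = u i + G i /\<^sub>R 2" for i
    define a where "a s = c s - n s - G (n s) /\<^sub>R 2" for s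
    have strain: "\<bar>2 * ((i - j) \<bullet> (v i - v j)) - ((dist (q i) (q j))\<^sup>2 - (dist i j)\<^sup>2)\<bar>
        \<le> (8 + 8 * N) * \<kappa>\<^sup>2" if "i \<in> V" "j \<in> V" for i j
    proof -
      have "norm (i - j) \<le> 2 * N"
        using norm_triangle_ineq4[of i j] N(2)[OF that(1)] N(2)[OF that(2)] by linarith
      moreover have "norm (u i - u j) \<le> 2 * \<kappa>"
        using norm_triangle_ineq4[of "u i" "u j"] u[OF that(1)] u[OF that(2)] by linarith
      moreover have "v i - v j = (u i - u j) + G (i - j) /\<^sub>R 2"
        by (simp add: v_def linear_diff[OF G] algebra_simps)
      moreover have "q i - q j = A ((i - j) + (u i - u j))"
        using q that by (simp add: linear_add[OF A(1)] linear_diff[OF A(1)])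
      ultimately show ?thesis
        using strain_expansion[OF G AG Gb \<kappa>(1,2), of "i - j" "2 * N" "u i - u j"]
        by (simp add: dist_norm)
    qed
    define \<eta> where "\<eta> = (8 + 8 * N + C1) * \<kappa>\<^sup>2"
    have \<eta>: "\<eta> \<ge> 0" using N(1) C1(1) by (simp add: \<eta>_def)
    have \<eta>1: "(8 + 8 * N) * \<kappa>\<^sup>2 \<le> \<eta>" "C1 * \<kappa>\<^sup>2 \<le> \<eta>"
      unfolding \<eta>_def by (rule mult_right_mono; use N(1) C1(1) in simp)+
    have "(\<Sum>(i, j)\<in>V \<times> V. \<bar>(i - j) \<bullet> (v i - v j)\<bar>) \<le> C0 * \<eta>"
    proof (rule C0(2)[OF \<eta>]; intro ballI allI impI)
      fix i j assume ij: "i \<in> V" "j \<in> V" "{i, j} \<in> edges (comb_type_of P)"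
      then have "dist (q i) (q j) = dist i j"
        using eq by (simp add: equivalent_def realization_of_def V_def comb_type_of_def)
      then show "\<bar>(i - j) \<bullet> (v i - v j)\<bar> \<le> \<eta>"
        using strain[OF ij(1,2)] \<eta>1(1) by simp
    next
      fix s i assume s: "s facet_of P" and i: "i \<in> V \<inter> s"
      have "i \<bullet> a s + v i \<bullet> n s = i \<bullet> c s - i \<bullet> n s + u i \<bullet> n s"
        by (simp add: a_def v_def inner_diff_right inner_add_left Gsym)
      \<comment> \<open>As \<open>(i + u i) \<bullet> c s\<close> and \<open>i \<bullet> n s\<close>
        both equal 1, the incidence error reduces to a product of two first-order
        quantities.\<close>
      also have "\<dots> = - (u i \<bullet> (c s - n s))"
        using c(1)[OF s i] n[OF s i] by (simp add: inner_add_left inner_diff_right)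
      finally have "\<bar>i \<bullet> a s + v i \<bullet> n s\<bar> \<le> norm (u i) * norm (c s - n s)"
        using Cauchy_Schwarz_ineq2[of "u i" "c s - n s"] by simp
      also have "\<dots> \<le> \<kappa> * (C1 * \<kappa>)"
        using u i c(2)[OF s] \<kappa>(1) by (intro mult_mono) auto
      also have "\<dots> \<le> \<eta>" using \<eta>1(2) by (simp add: power2_eq_square mult_ac)
      finally show "\<bar>i \<bullet> a s + v i \<bullet> facet_normal P s\<bar> \<le> \<eta>" by (simp add: n_def)
    qed
    moreover have "\<epsilon> \<le> (\<Sum>(i, j)\<in>V \<times> V. 2 * \<bar>(i - j) \<bullet> (v i - v j)\<bar> + (8 + 8 * N) * \<kappa>\<^sup>2)"
      unfolding \<epsilon>_def distortion_def
    proof (rule sum_mono, clarify)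
      fix i j assume "i \<in> V" "j \<in> V"
      from strain[OF this]
      show "\<bar>(dist (q i) (q j))\<^sup>2 - (dist i j)\<^sup>2\<bar> \<le> 2 * \<bar>(i - j) \<bullet> (v i - v j)\<bar> + (8 + 8 * N) * \<kappa>\<^sup>2"
        by linarith
    qed
    moreover have "\<dots> = 2 * (\<Sum>(i, j)\<in>V \<times> V. \<bar>(i - j) \<bullet> (v i - v j)\<bar>) + card (V \<times> V) * ((8 + 8 * N) * \<kappa>\<^sup>2)"
      by (simp add: case_prod_beta sum.distrib sum_distrib_left)
    ultimately have "\<epsilon> \<le> 2 * (C0 * \<eta>) + card (V \<times> V) * ((8 + 8 * N) * \<kappa>\<^sup>2)" by linarith
    also have "\<dots> = K * C2\<^sup>2 * \<epsilon> * \<epsilon>"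
      by (simp add: K_def \<eta>_def \<kappa>_def power2_eq_square algebra_simps)
    finally have "1 \<le> K * C2\<^sup>2 * \<epsilon>" using \<epsilon> by simp
    moreover have "(1 + K * C2\<^sup>2) * \<epsilon> < 1"
      using \<epsilon>K K by (simp add: pos_less_divide_eq add_pos_nonneg mult.commute)
    ultimately show False using \<epsilon> by (simp add: algebra_simps)
  qed
  ultimately show ?thesis by blast
qed

theorem theorem3p3:
  fixes P :: "'a::euclidean_space set"
  assumes "polytope P"
    and "aff_dim P = int DIM('a)"
    and "0 \<in> interior P"
    and "first_order_rigid P"
  shows "rigid P"
  unfolding rigid_def rigid_realization_def
proof (intro allI impI)
  let ?C = "comb_type_of P"
  define V where "V = {v. v extreme_point_of P}"
  have V: "finite V"
    using assms(1) finite_polyhedron_extreme_points polytope_imp_polyhedron by (auto simp: V_def)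
  fix m assume "motion ?C (realization_of P) m"
  then have m: "continuous_on {0..1} m" "m 0 = realization_of P"
    "\<And>x. x \<in> {0..1} \<Longrightarrow> m x \<in> REAL ?C \<and> equivalent ?C (m x) (realization_of P)"
    by (auto simp: motion_def path_def path_image_def pathstart_def)
  from distortion_gap[OF assms(1,3,4), folded V_def]
  obtain \<delta> where "\<delta> > 0" and *: "\<forall>q b. (q, b) \<in> REAL ?C \<longrightarrow>
      equivalent ?C (q, b) (realization_of P) \<longrightarrow> distortion V q < \<delta> \<longrightarrow> distortion V q = 0"
    by (elim exE conjE) (rule that)
  note \<delta> = this(1) *[rule_format]
  define f where "f x = distortion V (fst (m x))" for x
  have "continuous_on {0..1} (\<lambda>x. fst (m x) i)" for i
    by (rule continuous_on_product_then_coordinatewise[OF continuous_on_fst[OF m(1)]])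
  then have f: "continuous_on {0..1} f"
    unfolding f_def distortion_def case_prod_beta
    by (intro continuous_on_sum continuous_on_rabs continuous_on_diff continuous_on_power
        continuous_on_dist continuous_on_const)
  have f0: "f 0 = 0"
    by (auto simp: f_def distortion_def m(2) realization_of_def comb_type_of_def V_def intro!: sum.neutral)
  have "f x = 0" if x: "x \<in> {0..1}" for x
  proof (rule ccontr)
    assume "f x \<noteq> 0"
    then have pos: "0 < min (f x) (\<delta> / 2)"
      using distortion_nonneg[of V "fst (m x)"] \<delta>(1) by (simp add: f_def)
    \<comment> \<open>A continuous distortion starting at 0 would take a value strictly between 0
      and \<delta>, inside the gap; the minimum keeps this value at most \<open>f x\<close>.\<close>
    have "\<exists>y\<ge>0. y \<le> x \<and> f y = min (f x) (\<delta> / 2)"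
      using x pos f0 by (intro IVT' continuous_on_subset[OF f]) auto
    then obtain y where y: "0 \<le> y" "y \<le> x" "f y = min (f x) (\<delta> / 2)" by blast
    then have "y \<in> {0..1}" using x by simp
    with y(3) show False
      using \<delta>(2)[of "fst (m y)" "snd (m y)"] m(3)[of y] \<delta>(1) pos
      by (auto simp: f_def min_def split: if_splits)
  qed
  moreover have "dist (fst (m x) i) (fst (m x) j) = dist i j"
    if "f x = 0" "i \<in> V" "j \<in> V" for x i j
    using distortion_ge[OF V that(2,3), of "fst (m x)"] that(1) by (simp add: f_def)
  ultimately show "trivial_motion ?C (realization_of P) m"
    by (auto simp: trivial_motion_def congruent_realizations_def path_image_def
        realization_of_def comb_type_of_def V_def)
qed

end
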